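(* Let $t\in\mathbb{N}$, let $f:2^\Omega\to\mathbb{R}$ be a set function with $\Omega=\{1,\dots,n\}$, and let $F$ be its multilinear extension. Then $f$ is $t$-sos-submodular if and only if the polynomial $G(x,y,s):=F(x)+F(y)-F(x+y-s)-F(s)$ is $(t+2)$-sos modulo $I_0[x,y,s]$.
   Context: $\mathbb{N}$ includes $0$. The multilinear extension (MLE) of a set function $f:2^\Omega\to\mathbb{R}$ is the unique multilinear polynomial $F\in\mathbb{R}[x_1,\dots,x_n]$ (every variable appears with power at most $1$ in every monomial) with $F(1_S)=f(S)$ for all $S\subseteq\Omega$, where $1_S\in\{0,1\}^n$ is the indicator vector of $S$. For an ideal $I$ of a real polynomial ring, a polynomial $p$ is $t$-sos modulo $I$ if there are finitely many polynomials $q_1,\dots,q_m$ in that ring, each of degree at most $t$, with $p-\sum_{r=1}^m q_r^2\in I$. For $i\ne j$, $x_{-i,j}$ denotes the variables $x_1,\dots,x_n$ with $x_i,x_j$ removed, and $I_2[x_{-i,j}]=\langle x_k^2-x_k : k\neq i,j\rangle\subseteq\mathbb{R}[x_{-i,j}]$. The set function $f$ with MLE $F$ is $t$-sos-submodular if for all $i\neq j$ the polynomial $-\frac{\partial^2F(x)}{\partial x_i\partial x_j}$ (which does not involve $x_i,x_j$) is $t$-sos modulo $I_2[x_{-i,j}]$. With variables $x=(x_1,\dots,x_n)$, $y=(y_1,\dots,y_n)$, $s=(s_1,\dots,s_n)$, $I_0[x,y,s]=\langle\{x_i^2-x_i,\ x_iy_i-s_i,\ x_is_i-s_i,\ y_i^2-y_i,\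 y_is_i-s_i,\ s_i^2-s_i\}_{i=1,\dots,n}\rangle\subseteq\mathbb{R}[x,y,s]$. *)

theory Defs
  imports Complex_Main "HOL-Library.Poly_Mapping" "HOL-Library.Indicator_Function" "HOL-Algebra.Ideal"
begin

section \<open>Real polynomials in several variables\<close>

text \<open>
  A polynomial is a finitely supported map from monomials to coefficients, and a monomial is a
  finitely supported map from variables to exponents.  The ring structure (\<open>+\<close>, \<open>*\<close>, \<open>^\<close>, ...)
  is the convolution ring provided by \<^theory>\<open>HOL-Library.Poly_Mapping\<close>.  The type of variables
  may be larger than the set of variables actually allowed, so a polynomial ring is given by an
  explicit set \<open>V\<close> of variables.
\<close>

type_synonym 'v monom = "'v \<Rightarrow>\<^sub>0 nat"
type_synonym 'v mpoly = "'v monom \<Rightarrow>\<^sub>0 real"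

definition Const :: "real \<Rightarrow> 'v mpoly" where
  "Const c = Poly_Mapping.single 0 c"

definition Var :: "'v \<Rightarrow> 'v mpoly" where
  "Var v = Poly_Mapping.single (Poly_Mapping.single v 1) 1"

definition vars :: "'v mpoly \<Rightarrow> 'v set" where
  "vars p = (\<Union>m\<in>Poly_Mapping.keys p. Poly_Mapping.keys m)"

definition monom_degree :: "'v monom \<Rightarrow> nat" where
  "monom_degree m = (\<Sum>v\<in>Poly_Mapping.keys m. Poly_Mapping.lookup m v)"

text \<open>The zero polynomial gets degree \<open>0\<close>, so it has degree at most \<open>t\<close> for every natural \<open>t\<close>.\<close>

definition total_degree :: "'v mpoly \<Rightarrow> nat" where
  "total_degree p = Max (insert 0 (monom_degree ` Poly_Mapping.keys p))"

definition mpoly_eval :: "('v \<Rightarrow> real) \<Rightarrow> 'v mpoly \<Rightarrow> real" where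
  "mpoly_eval a p =
     (\<Sum>m\<in>Poly_Mapping.keys p. Poly_Mapping.lookup p m *
        (\<Prod>v\<in>Poly_Mapping.keys m. a v ^ Poly_Mapping.lookup m v))"

definition mpoly_subst :: "('v \<Rightarrow> 'w mpoly) \<Rightarrow> 'v mpoly \<Rightarrow> 'w mpoly" where
  "mpoly_subst \<sigma> p =
     (\<Sum>m\<in>Poly_Mapping.keys p. Const (Poly_Mapping.lookup p m) *
        (\<Prod>v\<in>Poly_Mapping.keys m. \<sigma> v ^ Poly_Mapping.lookup m v))"

text \<open>
  The subtraction of exponents is truncated, but a monomial not containing \<open>v\<close> contributes the
  coefficient \<open>0\<close>.
\<close>

definition mpoly_deriv :: "'v \<Rightarrow> 'v mpoly \<Rightarrow> 'v mpoly" where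
  "mpoly_deriv v p =
     (\<Sum>m\<in>Poly_Mapping.keys p.
        Poly_Mapping.single (m - Poly_Mapping.single v 1)
          (Poly_Mapping.lookup p m * real (Poly_Mapping.lookup m v)))"

definition mpoly_ring :: "'v set \<Rightarrow> 'v mpoly ring" where
  "mpoly_ring V = \<lparr>carrier = {p. vars p \<subseteq> V}, mult = (*), one = 1, zero = 0, add = (+)\<rparr>"

definition mpoly_ideal :: "'v set \<Rightarrow> 'v mpoly set \<Rightarrow> 'v mpoly set" where
  "mpoly_ideal V B = genideal (mpoly_ring V) B"


section \<open>Sums of squares modulo an ideal\<close>

definition sos_modulo :: "'v set \<Rightarrow> nat \<Rightarrow> 'v mpoly set \<Rightarrow> 'v mpoly \<Rightarrow> bool" where
  "sos_modulo V t I p \<longleftrightarrow>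
     (\<exists>qs. (\<forall>q\<in>set qs. q \<in> carrier (mpoly_ring V) \<and> total_degree q \<le> t) \<and>
           p - (\<Sum>q\<leftarrow>qs. q ^ 2) \<in> I)"


section \<open>Set functions\<close>

text \<open>
  A set function on \<open>{1..n}\<close> is represented by a function on all sets of naturals; only its values
  on subsets of \<open>{1..n}\<close> are ever used.
\<close>

definition multilinear :: "'v mpoly \<Rightarrow> bool" where
  "multilinear p \<longleftrightarrow> (\<forall>m\<in>Poly_Mapping.keys p. \<forall>v. Poly_Mapping.lookup m v \<le> 1)"

definition is_MLE :: "nat \<Rightarrow> (nat set \<Rightarrow> real) \<Rightarrow> nat mpoly \<Rightarrow> bool" where
  "is_MLE n f F \<longleftrightarrow>
     F \<in> carrier (mpoly_ring {1..n}) \<and> multilinear F \<and>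
     (\<forall>S. S \<subseteq> {1..n} \<longrightarrow> mpoly_eval (indicator S) F = f S)"

text \<open>Existence and uniqueness are proved below, in \<open>ex1_MLE\<close>.\<close>

definition MLE :: "nat \<Rightarrow> (nat set \<Rightarrow> real) \<Rightarrow> nat mpoly" where
  "MLE n f = (THE F. is_MLE n f F)"

definition I2 :: "nat set \<Rightarrow> nat mpoly set" where
  "I2 V = mpoly_ideal V {Var k ^ 2 - Var k |k. k \<in> V}"

definition sos_submodular :: "nat \<Rightarrow> nat \<Rightarrow> (nat set \<Rightarrow> real) \<Rightarrow> bool" where
  "sos_submodular t n f \<longleftrightarrow>
     (\<forall>i\<in>{1..n}. \<forall>j\<in>{1..n}. i \<noteq> j \<longrightarrow>
        sos_modulo ({1..n} - {i, j}) t (I2 ({1..n} - {i, j}))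
          (- mpoly_deriv i (mpoly_deriv j (MLE n f))))"


section \<open>The ring in the variables x, y, s\<close>

datatype xys = Xv nat | Yv nat | Sv nat

definition xys_vars :: "nat \<Rightarrow> xys set" where
  "xys_vars n = Xv ` {1..n} \<union> Yv ` {1..n} \<union> Sv ` {1..n}"

definition I0 :: "nat \<Rightarrow> xys mpoly set" where
  "I0 n = mpoly_ideal (xys_vars n)
     (\<Union>i\<in>{1..n}.
        {Var (Xv i) ^ 2 - Var (Xv i), Var (Xv i) * Var (Yv i) - Var (Sv i),
         Var (Xv i) * Var (Sv i) - Var (Sv i), Var (Yv i) ^ 2 - Var (Yv i),
         Var (Yv i) * Var (Sv i) - Var (Sv i), Var (Sv i) ^ 2 - Var (Sv i)})"


section \<open>Well-definedness\<close>

lemma vars_add: "vars (p + q) \<subseteq> vars p \<union> vars q"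
  using Poly_Mapping.keys_add[of p q] unfolding vars_def by blast

lemma vars_mult: "vars (p * q) \<subseteq> vars p \<union> vars q"
proof
  fix v assume "v \<in> vars (p * q)"
  then obtain m where m: "m \<in> Poly_Mapping.keys (p * q)" "v \<in> Poly_Mapping.keys m"
    unfolding vars_def by blast
  then obtain a b where "m = a + b" "a \<in> Poly_Mapping.keys p" "b \<in> Poly_Mapping.keys q"
    using Poly_Mapping.keys_mult[of p q] by blast
  then show "v \<in> vars p \<union> vars q"
    using m(2) Poly_Mapping.keys_add[of a b] unfolding vars_def by blast
qed

lemma vars_simps: "vars 0 = {}" "vars 1 = {}" "vars (- p) = vars p"
  by (simp_all add: vars_def)

lemma cring_mpoly_ring: "cring (mpoly_ring V)"
proof (rule cringI)
  show "abelian_group (mpoly_ring V)"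
  proof (rule abelian_groupI)
    fix p assume "p \<in> carrier (mpoly_ring V)"
    then show "\<exists>q\<in>carrier (mpoly_ring V). q \<oplus>\<^bsub>mpoly_ring V\<^esub> p = \<zero>\<^bsub>mpoly_ring V\<^esub>"
      by (intro bexI[of _ "- p"]) (auto simp: mpoly_ring_def vars_simps)
  next
    fix p q assume "p \<in> carrier (mpoly_ring V)" "q \<in> carrier (mpoly_ring V)"
    then show "p \<oplus>\<^bsub>mpoly_ring V\<^esub> q \<in> carrier (mpoly_ring V)"
      using vars_add[of p q] by (simp add: mpoly_ring_def) blast
  qed (simp_all add: mpoly_ring_def vars_simps add.assoc add.commute)
  show "Group.comm_monoid (mpoly_ring V)"
  proof (rule comm_monoidI)
    fix p q assume "p \<in> carrier (mpoly_ring V)" "q \<in> carrier (mpoly_ring V)"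
    then show "p \<otimes>\<^bsub>mpoly_ring V\<^esub> q \<in> carrier (mpoly_ring V)"
      using vars_mult[of p q] by (simp add: mpoly_ring_def) blast
  qed (simp_all add: mpoly_ring_def vars_simps mult.assoc mult.commute)
qed (simp add: mpoly_ring_def distrib_right)

definition set_monom :: "'v set \<Rightarrow> 'v monom" where
  "set_monom T = (\<Sum>v\<in>T. Poly_Mapping.single v 1)"

lemma lookup_set_monom:
  "finite T \<Longrightarrow> Poly_Mapping.lookup (set_monom T) v = (if v \<in> T then 1 else 0)"
  by (auto simp: set_monom_def lookup_sum lookup_single when_def)

lemma keys_set_monom: "finite T \<Longrightarrow> Poly_Mapping.keys (set_monom T) = T"
  by (auto simp: in_keys_iff lookup_set_monom split: if_splits)

lemma inj_set_monom: "finite V \<Longrightarrow> inj_on set_monom (Pow V)"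
  by (rule inj_onI) (metis PowD finite_subset keys_set_monom)

lemma keys_multilinear:
  assumes "vars F \<subseteq> V" "multilinear F"
  shows "Poly_Mapping.keys F \<subseteq> set_monom ` Pow V"
proof
  fix m assume m: "m \<in> Poly_Mapping.keys F"
  have "m = set_monom (Poly_Mapping.keys m)"
  proof (rule poly_mapping_eqI)
    fix v
    have "Poly_Mapping.lookup m v \<le> 1"
      using m assms(2) by (auto simp: multilinear_def)
    then show "Poly_Mapping.lookup m v = Poly_Mapping.lookup (set_monom (Poly_Mapping.keys m)) v"
      by (cases "Poly_Mapping.lookup m v") (auto simp: lookup_set_monom in_keys_iff)
  qed
  then show "m \<in> set_monom ` Pow V"
    using m assms(1) unfolding vars_def by blast
qed

lemma eval_multilinear:
  assumes "finite V" "Poly_Mapping.keys F \<subseteq> set_monom ` Pow V" "S \<subseteq> V"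
  shows "mpoly_eval (indicator S) F = (\<Sum>T\<in>Pow S. Poly_Mapping.lookup F (set_monom T))"
proof -
  have "mpoly_eval (indicator S) F =
      (\<Sum>m\<in>set_monom ` Pow V. Poly_Mapping.lookup F m *
        (\<Prod>v\<in>Poly_Mapping.keys m. indicator S v ^ Poly_Mapping.lookup m v))"
    unfolding mpoly_eval_def using assms
    by (intro sum.mono_neutral_left) (auto simp: in_keys_iff)
  also have "\<dots> = (\<Sum>T\<in>Pow V. Poly_Mapping.lookup F (set_monom T) * (if T \<subseteq> S then 1 else 0))"
  proof (subst sum.reindex[OF inj_set_monom[OF assms(1)]], rule sum.cong[OF refl])
    fix T assume "T \<in> Pow V"
    then have T: "finite T" using assms(1) finite_subset by blast
    have "(\<Prod>v\<in>T. indicator S v ^ (if v \<in> T then 1 else 0)) = (if T \<subseteq> S then 1 else (0::real))"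
    proof (cases "T \<subseteq> S")
      case True
      then show ?thesis by (auto intro!: prod.neutral)
    next
      case False
      then show ?thesis using T by (auto simp: prod_zero_iff indicator_eq_0_iff)
    qed
    then show "((\<lambda>m. Poly_Mapping.lookup F m *
        (\<Prod>v\<in>Poly_Mapping.keys m. indicator S v ^ Poly_Mapping.lookup m v)) \<circ> set_monom) T =
        Poly_Mapping.lookup F (set_monom T) * (if T \<subseteq> S then 1 else 0)"
      using T by (simp add: keys_set_monom lookup_set_monom)
  qed
  also have "\<dots> = (\<Sum>T\<in>Pow S. Poly_Mapping.lookup F (set_monom T))"
    using assms by (intro sum.mono_neutral_cong_right) auto
  finally show ?thesis .
qed

lemma subset_sum_unique:
  fixes c d :: "'v set \<Rightarrow> real"
  assumes "finite S" "\<And>R. R \<subseteq> S \<Longrightarrow> (\<Sum>T\<in>Pow R. c T) = (\<Sum>T\<in>Pow R. d T)"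
  shows "c S = d S"
  using assms
proof (induction S rule: finite_psubset_induct)
  case (psubset S)
  have "c T = d T" if "T \<in> Pow S - {S}" for T
    using that psubset.prems by (intro psubset.IH) auto
  then have "(\<Sum>T\<in>Pow S - {S}. c T) = (\<Sum>T\<in>Pow S - {S}. d T)" by (rule sum.cong[OF refl])
  moreover have "(\<Sum>T\<in>Pow S. c T) = (\<Sum>T\<in>Pow S. d T)" using psubset.prems by blast
  ultimately show ?case
    using psubset.hyps sum.remove[of "Pow S" S c] sum.remove[of "Pow S" S d] by auto
qed

lemma subset_sum_exists:
  fixes f :: "'v set \<Rightarrow> real"
  assumes "finite V"
  shows "\<exists>c. \<forall>S. S \<subseteq> V \<longrightarrow> (\<Sum>T\<in>Pow S. c T) = f S"
  using assms
proof (induction V arbitrary: f rule: finite_induct)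
  case empty
  show ?case by (intro exI[of _ f]) auto
next
  case (insert a V)
  obtain c where c: "\<And>S. S \<subseteq> V \<Longrightarrow> (\<Sum>T\<in>Pow S. c T) = f S"
    using insert.IH[of f] by blast
  obtain d where d: "\<And>S. S \<subseteq> V \<Longrightarrow> (\<Sum>T\<in>Pow S. d T) = f (insert a S) - f S"
    using insert.IH[of "\<lambda>S. f (insert a S) - f S"] by blast
  define e where "e T = (if a \<in> T then d (T - {a}) else c T)" for T
  have without: "(\<Sum>T\<in>Pow S. e T) = f S" if "S \<subseteq> V" for S
  proof -
    have "(\<Sum>T\<in>Pow S. e T) = (\<Sum>T\<in>Pow S. c T)"
      using that insert.hyps by (intro sum.cong) (auto simp: e_def)
    then show ?thesis using c that by simp
  qed
  have "(\<Sum>T\<in>Pow S. e T) = f S" if S: "S \<subseteq> insert a V" for S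
  proof (cases "a \<in> S")
    case False
    then show ?thesis using S without by blast
  next
    case True
    define R where "R = S - {a}"
    have R: "R \<subseteq> V" "S = insert a R" "a \<notin> R" using S True by (auto simp: R_def)
    have fin: "finite R" using R(1) insert.hyps(1) finite_subset by blast
    have inj: "inj_on (insert a) (Pow R)"
      using R(3) by (intro inj_onI) (metis PowD insert_ident subsetD)
    have "(\<Sum>T\<in>Pow S. e T) = (\<Sum>T\<in>Pow R. e T) + (\<Sum>T\<in>insert a ` Pow R. e T)"
      unfolding R(2) Pow_insert using fin R(3) by (intro sum.union_disjoint) auto
    also have "(\<Sum>T\<in>insert a ` Pow R. e T) = (\<Sum>T\<in>Pow R. d T)"
    proof (subst sum.reindex[OF inj], rule sum.cong[OF refl])
      fix T assume "T \<in> Pow R"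
      then have "insert a T - {a} = T" using R(3) by blast
      then show "(e \<circ> insert a) T = d T" by (simp add: e_def)
    qed
    finally show ?thesis using without[OF R(1)] d[OF R(1)] R(2) by simp
  qed
  then show ?case by blast
qed

lemma ex1_MLE: "\<exists>!F. is_MLE n f F"
proof (rule ex_ex1I)
  let ?V = "{1..n}"
  obtain c where c: "\<And>S. S \<subseteq> ?V \<Longrightarrow> (\<Sum>T\<in>Pow S. c T) = f S"
    using subset_sum_exists[of ?V f] by auto
  define F :: "nat mpoly" where "F = (\<Sum>T\<in>Pow ?V. Poly_Mapping.single (set_monom T) (c T))"
  have keys: "Poly_Mapping.keys F \<subseteq> set_monom ` Pow ?V"
    unfolding F_def using keys_sum[of "\<lambda>T. Poly_Mapping.single (set_monom T) (c T)" "Pow ?V"]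
    by (fastforce split: if_splits)
  have fin: "finite T" if "T \<subseteq> ?V" for T using that finite_subset by blast
  have coeff: "Poly_Mapping.lookup F (set_monom T) = c T" if "T \<subseteq> ?V" for T
  proof -
    have "Poly_Mapping.lookup F (set_monom T) = (\<Sum>U\<in>Pow ?V. if U = T then c U else 0)"
      unfolding F_def lookup_sum lookup_single
      using that inj_set_monom[of ?V] by (intro sum.cong) (auto simp: when_def inj_on_def)
    then show ?thesis using that by simp
  qed
  have keysE: "\<exists>T. T \<subseteq> ?V \<and> m = set_monom T \<and> finite T" if "m \<in> Poly_Mapping.keys F" for m
    using that keys fin by blast
  have "vars F \<subseteq> ?V"
  proof
    fix v assume "v \<in> vars F"
    then obtain m where m: "m \<in> Poly_Mapping.keys F" "v \<in> Poly_Mapping.keys m"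
      unfolding vars_def by blast
    then show "v \<in> ?V" using keysE[of m] keys_set_monom by blast
  qed
  moreover have "multilinear F"
    unfolding multilinear_def
  proof (intro ballI allI)
    fix m v assume "m \<in> Poly_Mapping.keys F"
    then obtain T where "m = set_monom T" "finite T" using keysE by blast
    then show "Poly_Mapping.lookup m v \<le> 1" by (simp add: lookup_set_monom)
  qed
  moreover have "mpoly_eval (indicator S) F = f S" if "S \<subseteq> ?V" for S
  proof -
    have "mpoly_eval (indicator S) F = (\<Sum>T\<in>Pow S. Poly_Mapping.lookup F (set_monom T))"
      using that keys by (intro eval_multilinear[of ?V]) auto
    also have "\<dots> = (\<Sum>T\<in>Pow S. c T)"
      using that by (intro sum.cong refl coeff) auto
    finally show ?thesis using c that by simp
  qed
  ultimately show "\<exists>F. is_MLE n f F"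
    by (auto simp: is_MLE_def mpoly_ring_def)
next
  let ?V = "{1..n}"
  fix F F' assume F: "is_MLE n f F" and F': "is_MLE n f F'"
  have keys: "Poly_Mapping.keys F \<subseteq> set_monom ` Pow ?V" "Poly_Mapping.keys F' \<subseteq> set_monom ` Pow ?V"
    using F F' keys_multilinear by (auto simp: is_MLE_def mpoly_ring_def)
  have eq: "Poly_Mapping.lookup F (set_monom T) = Poly_Mapping.lookup F' (set_monom T)"
    if T: "T \<subseteq> ?V" for T
  proof (rule subset_sum_unique[where c = "\<lambda>T. Poly_Mapping.lookup F (set_monom T)"])
    show "finite T" using T finite_subset by blast
    fix R assume "R \<subseteq> T"
    then have R: "R \<subseteq> ?V" using T by blast
    have "mpoly_eval (indicator R) F = mpoly_eval (indicator R) F'"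
      using F F' R by (simp add: is_MLE_def)
    then show "(\<Sum>T\<in>Pow R. Poly_Mapping.lookup F (set_monom T)) =
        (\<Sum>T\<in>Pow R. Poly_Mapping.lookup F' (set_monom T))"
      using eval_multilinear[of ?V _ R] keys R by simp
  qed
  show "F = F'"
  proof (rule poly_mapping_eqI)
    fix m
    show "Poly_Mapping.lookup F m = Poly_Mapping.lookup F' m"
    proof (cases "m \<in> set_monom ` Pow ?V")
      case True
      then show ?thesis using eq by auto
    next
      case False
      then show ?thesis using keys by (metis in_keys_iff subsetD)
    qed
  qed
qed

lemma is_MLE_MLE: "is_MLE n f (MLE n f)"
  unfolding MLE_def by (rule theI'[OF ex1_MLE])

end

theory Submission
  imports Defs
begin

text \<open>
  Both ideals are the vanishing ideals of finite sets of points: \<open>I2\<close> of the cube (lemma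
  \<open>I2_eq_vanishing\<close>) and \<open>I0\<close> of the points \<open>(x, y, s)\<close> where \<open>x\<close>, \<open>y\<close>, \<open>s\<close> are the indicator
  vectors of \<open>A\<close>, \<open>B\<close>, \<open>A \<inter> B\<close> for subsets \<open>A\<close>, \<open>B\<close> of the ground set (lemma
  \<open>I0_eq_vanishing\<close>).  Hence being a sum of squares modulo the ideal is a statement about values:
  on the points in question, the polynomial agrees with a sum of squares of polynomials of bounded
  degree.  At the point of the pair \<open>A\<close>, \<open>B\<close>, the polynomial \<open>G\<close> has the value
  \<open>f A + f B - f (A \<union> B) - f (A \<inter> B)\<close>, the defect of submodularity, and at the indicator vector of
  a set \<open>S\<close> containing neither \<open>i\<close> nor \<open>j\<close> the second derivative of the multilinear extension is
  the second difference \<open>second_diff f i j S\<close>.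

  From derivatives to \<open>G\<close>: adding the elements of \<open>A - B\<close> and of \<open>B - A\<close> to \<open>A \<inter> B\<close> one at a
  time writes the defect as a sum of negative second differences over the pairs \<open>(i, j)\<close> in
  \<open>(A - B) \<times> (B - A)\<close> (lemma \<open>submodularity_defect\<close>).  Such a pair is selected by
  \<open>(x\<^sub>i - s\<^sub>i) (y\<^sub>j - s\<^sub>j)\<close>, which on these points is 0 or 1 and so equals its own square, and the set at
  which the difference is taken has coordinates that are affine in \<open>x\<close>, \<open>y\<close>, \<open>s\<close>.  Each term is
  therefore a sum of squares of polynomials of degree at most \<open>t + 2\<close>.

  From \<open>G\<close> to derivatives: at \<open>A = S \<union> {i}\<close>, \<open>B = S \<union> {j}\<close> the value of \<open>G\<close> is the negative second
  difference at \<open>S\<close>, so the squares are there already, but their degree is too large by 2.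
  The defect is zero for nested \<open>A\<close> and \<open>B\<close>, and so is every squared \<open>q\<close> there, because a sum of
  squares vanishes only if each of them does.  Hence \<open>q\<close> at \<open>(S \<union> {i}, S \<union> {j})\<close> equals the
  mixed difference of \<open>q\<close> obtained by removing \<open>i\<close> from the first set and \<open>j\<close> from the second, and
  taking this difference lowers the degree by 2 (lemma \<open>mixed_diff_poly\<close>).
\<close>


section \<open>Polynomials of bounded degree\<close>

definition polys_le :: "'v set \<Rightarrow> nat \<Rightarrow> 'v mpoly set" where
  "polys_le V d = {p. vars p \<subseteq> V \<and> total_degree p \<le> d}"

lemma polys_le_iff:
  "p \<in> polys_le V d \<longleftrightarrow>
     (\<forall>m\<in>Poly_Mapping.keys p. Poly_Mapping.keys m \<subseteq> V \<and> monom_degree m \<le> d)"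
  unfolding polys_le_def vars_def total_degree_def by (auto simp: Max_le_iff)

lemma polys_le_total_degree: "vars p \<subseteq> V \<Longrightarrow> p \<in> polys_le V (total_degree p)"
  by (simp add: polys_le_def)

lemma polys_le_vars: "p \<in> polys_le V d \<Longrightarrow> vars p \<subseteq> V"
  by (simp add: polys_le_def)

lemma polys_le_mono: "p \<in> polys_le V d \<Longrightarrow> V \<subseteq> W \<Longrightarrow> d \<le> e \<Longrightarrow> p \<in> polys_le W e"
  by (auto simp: polys_le_def)

lemma monom_degree_superset:
  "finite K \<Longrightarrow> Poly_Mapping.keys m \<subseteq> K \<Longrightarrow> monom_degree m = (\<Sum>v\<in>K. Poly_Mapping.lookup m v)"
  unfolding monom_degree_def by (rule sum.mono_neutral_left) (auto simp: in_keys_iff)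

lemma monom_degree_add: "monom_degree (m + m') = monom_degree m + monom_degree m'"
proof -
  let ?K = "Poly_Mapping.keys m \<union> Poly_Mapping.keys m'"
  have "monom_degree (m + m') = (\<Sum>v\<in>?K. Poly_Mapping.lookup (m + m') v)"
    using Poly_Mapping.keys_add[of m m'] by (intro monom_degree_superset) auto
  also have "\<dots> = (\<Sum>v\<in>?K. Poly_Mapping.lookup m v) + (\<Sum>v\<in>?K. Poly_Mapping.lookup m' v)"
    by (simp add: lookup_add sum.distrib)
  finally show ?thesis by (simp add: monom_degree_superset[of ?K])
qed

lemma polys_le_Const: "Const c \<in> polys_le V d"
  by (simp add: polys_le_iff Const_def monom_degree_def)

lemma polys_le_one: "1 \<in> polys_le V d"
  using polys_le_Const[of 1 V d] by (simp add: Const_def)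

lemma polys_le_zero: "0 \<in> polys_le V d"
  by (simp add: polys_le_iff)

lemma polys_le_Var: "v \<in> V \<Longrightarrow> Var v \<in> polys_le V 1"
  by (simp add: polys_le_iff Var_def monom_degree_def)

lemma polys_le_add: "p \<in> polys_le V d \<Longrightarrow> q \<in> polys_le V d \<Longrightarrow> p + q \<in> polys_le V d"
  using Poly_Mapping.keys_add[of p q] unfolding polys_le_iff by blast

lemma polys_le_uminus: "p \<in> polys_le V d \<Longrightarrow> - p \<in> polys_le V d"
  by (simp add: polys_le_iff)

lemma polys_le_diff: "p \<in> polys_le V d \<Longrightarrow> q \<in> polys_le V d \<Longrightarrow> p - q \<in> polys_le V d"
  using polys_le_add[of p V d "- q"] polys_le_uminus[of q] by simp

lemma polys_le_sum:
  "(\<And>x. x \<in> A \<Longrightarrow> g x \<in> polys_le V d) \<Longrightarrow> (\<Sum>x\<in>A. g x) \<in> polys_le V d"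
  by (induction A rule: infinite_finite_induct) (auto intro: polys_le_zero polys_le_add)

lemma polys_le_mult:
  assumes "p \<in> polys_le V d" "q \<in> polys_le V e"
  shows "p * q \<in> polys_le V (d + e)"
  unfolding polys_le_iff
proof
  fix m assume "m \<in> Poly_Mapping.keys (p * q)"
  then obtain a b where ab: "m = a + b" "a \<in> Poly_Mapping.keys p" "b \<in> Poly_Mapping.keys q"
    using Poly_Mapping.keys_mult[of p q] by blast
  then show "Poly_Mapping.keys m \<subseteq> V \<and> monom_degree m \<le> d + e"
    using assms Poly_Mapping.keys_add[of a b] unfolding polys_le_iff
    by (fastforce simp: monom_degree_add intro: add_mono)
qed

lemma polys_le_power: "p \<in> polys_le V d \<Longrightarrow> p ^ k \<in> polys_le V (k * d)"
  by (induction k) (auto intro: polys_le_one polys_le_mult)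

lemma polys_le_prod:
  "(\<And>x. x \<in> A \<Longrightarrow> g x \<in> polys_le V (d x)) \<Longrightarrow> (\<Prod>x\<in>A. g x) \<in> polys_le V (\<Sum>x\<in>A. d x)"
  by (induction A rule: infinite_finite_induct) (auto intro: polys_le_one polys_le_mult)

lemma polys_le_prod_power:
  "(\<And>v. v \<in> K \<Longrightarrow> \<sigma> v \<in> polys_le W 1) \<Longrightarrow>
    (\<Prod>v\<in>K. \<sigma> v ^ e v) \<in> polys_le W (\<Sum>v\<in>K. e v)"
  by (rule polys_le_prod) (metis polys_le_power mult.right_neutral)

lemma polys_le_Const_mult: "p \<in> polys_le V d \<Longrightarrow> Const c * p \<in> polys_le V d"
  using polys_le_mult[OF polys_le_Const[of c V 0]] by simp

text \<open>Affine changes of variables do not raise the degree.\<close>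

lemma polys_le_subst:
  assumes "p \<in> polys_le V d" "\<And>v. v \<in> V \<Longrightarrow> \<sigma> v \<in> polys_le W 1"
  shows "mpoly_subst \<sigma> p \<in> polys_le W d"
  unfolding mpoly_subst_def
proof (intro polys_le_sum polys_le_Const_mult)
  fix m assume m: "m \<in> Poly_Mapping.keys p"
  show "(\<Prod>v\<in>Poly_Mapping.keys m. \<sigma> v ^ Poly_Mapping.lookup m v) \<in> polys_le W d"
    using m assms unfolding polys_le_iff[of p]
    by (intro polys_le_mono[OF polys_le_prod_power[of "Poly_Mapping.keys m"]])
      (auto simp: monom_degree_def)
qed

lemma vars_closed:
  shows "vars (Const c) \<subseteq> V"
    and "v \<in> V \<Longrightarrow> vars (Var v) \<subseteq> V"
    and "vars p \<subseteq> V \<Longrightarrow> vars q \<subseteq> V \<Longrightarrow> vars (p + q) \<subseteq> V"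
    and "vars p \<subseteq> V \<Longrightarrow> vars q \<subseteq> V \<Longrightarrow> vars (p - q) \<subseteq> V"
    and "vars p \<subseteq> V \<Longrightarrow> vars q \<subseteq> V \<Longrightarrow> vars (p * q) \<subseteq> V"
    and "vars p \<subseteq> V \<Longrightarrow> vars (p ^ k) \<subseteq> V"
    and "(\<And>x. x \<in> A \<Longrightarrow> vars (g x) \<subseteq> V) \<Longrightarrow> vars (\<Prod>x\<in>A. g x) \<subseteq> V"
proof -
  show mult: "vars p \<subseteq> V \<Longrightarrow> vars q \<subseteq> V \<Longrightarrow> vars (p * q) \<subseteq> V" for p q
    using vars_mult[of p q] by blast
  show "vars p \<subseteq> V \<Longrightarrow> vars (p ^ k) \<subseteq> V"
    by (induction k) (auto simp: vars_simps intro: mult[THEN subsetD])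
  show "(\<And>x. x \<in> A \<Longrightarrow> vars (g x) \<subseteq> V) \<Longrightarrow> vars (\<Prod>x\<in>A. g x) \<subseteq> V"
    by (induction A rule: infinite_finite_induct)
      (simp_all add: vars_simps mult)
  show "vars p \<subseteq> V \<Longrightarrow> vars q \<subseteq> V \<Longrightarrow> vars (p + q) \<subseteq> V"
    and "vars p \<subseteq> V \<Longrightarrow> vars q \<subseteq> V \<Longrightarrow> vars (p - q) \<subseteq> V"
    using vars_add[of p q] vars_add[of p "- q"] by (simp_all add: vars_simps) blast+
qed (auto simp: vars_def Const_def Var_def split: if_splits)


section \<open>Evaluation as a ring homomorphism\<close>

definition monom_value :: "('v \<Rightarrow> real) \<Rightarrow> 'v monom \<Rightarrow> real" where
  "monom_value a m = (\<Prod>v\<in>Poly_Mapping.keys m. a v ^ Poly_Mapping.lookup m v)"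

lemma monom_value_superset:
  "finite K \<Longrightarrow> Poly_Mapping.keys m \<subseteq> K \<Longrightarrow>
    monom_value a m = (\<Prod>v\<in>K. a v ^ Poly_Mapping.lookup m v)"
  unfolding monom_value_def by (rule prod.mono_neutral_left) (auto simp: in_keys_iff)

lemma monom_value_add: "monom_value a (m + m') = monom_value a m * monom_value a m'"
proof -
  let ?K = "Poly_Mapping.keys m \<union> Poly_Mapping.keys m'"
  have "monom_value a (m + m') = (\<Prod>v\<in>?K. a v ^ Poly_Mapping.lookup (m + m') v)"
    using Poly_Mapping.keys_add[of m m'] by (intro monom_value_superset) auto
  also have "\<dots> = (\<Prod>v\<in>?K. a v ^ Poly_Mapping.lookup m v) * (\<Prod>v\<in>?K. a v ^ Poly_Mapping.lookup m' v)"
    by (simp add: lookup_add power_add prod.distrib)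
  finally show ?thesis by (simp add: monom_value_superset[of ?K])
qed

lemma eval_monom_value:
  "mpoly_eval a p = (\<Sum>m\<in>Poly_Mapping.keys p. Poly_Mapping.lookup p m * monom_value a m)"
  by (simp add: mpoly_eval_def monom_value_def)

lemma eval_superset:
  "finite M \<Longrightarrow> Poly_Mapping.keys p \<subseteq> M \<Longrightarrow>
    mpoly_eval a p = (\<Sum>m\<in>M. Poly_Mapping.lookup p m * monom_value a m)"
  unfolding eval_monom_value by (rule sum.mono_neutral_left) (auto simp: in_keys_iff)

lemma eval_single: "mpoly_eval a (Poly_Mapping.single m c) = c * monom_value a m"
  by (simp add: eval_superset[of "{m}"])

lemma eval_add: "mpoly_eval a (p + q) = mpoly_eval a p + mpoly_eval a q"
proof -
  let ?M = "Poly_Mapping.keys p \<union> Poly_Mapping.keys q"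
  have "mpoly_eval a (p + q) = (\<Sum>m\<in>?M. Poly_Mapping.lookup (p + q) m * monom_value a m)"
    using Poly_Mapping.keys_add[of p q] by (intro eval_superset) auto
  also have "\<dots> = (\<Sum>m\<in>?M. Poly_Mapping.lookup p m * monom_value a m)
      + (\<Sum>m\<in>?M. Poly_Mapping.lookup q m * monom_value a m)"
    by (simp add: lookup_add distrib_right sum.distrib)
  finally show ?thesis by (simp add: eval_superset[of ?M])
qed

lemma eval_uminus: "mpoly_eval a (- p) = - mpoly_eval a p"
  by (simp add: eval_monom_value sum_negf)

lemma eval_diff: "mpoly_eval a (p - q) = mpoly_eval a p - mpoly_eval a q"
  using eval_add[of a p "- q"] by (simp add: eval_uminus)

lemma eval_sum: "mpoly_eval a (\<Sum>x\<in>A. g x) = (\<Sum>x\<in>A. mpoly_eval a (g x))"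
  by (induction A rule: infinite_finite_induct) (auto simp: eval_add eval_superset[of "{}"])

lemma mpoly_eq_sum_single:
  "p = (\<Sum>m\<in>Poly_Mapping.keys p. Poly_Mapping.single m (Poly_Mapping.lookup p m))"
  by (rule poly_mapping_eqI) (auto simp: lookup_sum lookup_single when_def in_keys_iff)

lemma eval_mult: "mpoly_eval a (p * q) = mpoly_eval a p * mpoly_eval a q"
proof -
  have "p * q = (\<Sum>m\<in>Poly_Mapping.keys p. \<Sum>m'\<in>Poly_Mapping.keys q.
      Poly_Mapping.single (m + m') (Poly_Mapping.lookup p m * Poly_Mapping.lookup q m'))"
    by (subst mpoly_eq_sum_single[of p], subst mpoly_eq_sum_single[of q])
      (simp only: sum_product mult_single)
  then have "mpoly_eval a (p * q) = (\<Sum>m\<in>Poly_Mapping.keys p. \<Sum>m'\<in>Poly_Mapping.keys q.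
      Poly_Mapping.lookup p m * Poly_Mapping.lookup q m' * (monom_value a m * monom_value a m'))"
    by (simp only: eval_sum eval_single monom_value_add)
  then show ?thesis
    by (simp only: eval_monom_value sum_product mult.assoc mult.left_commute)
qed

lemma eval_Const: "mpoly_eval a (Const c) = c"
  by (simp add: Const_def eval_single monom_value_def)

lemma eval_Var: "mpoly_eval a (Var v) = a v"
  by (simp add: Var_def eval_single monom_value_def)

lemma eval_one: "mpoly_eval a 1 = 1"
  using eval_Const[of a 1] by (simp add: Const_def)

lemma eval_zero: "mpoly_eval a 0 = 0"
  by (simp add: eval_superset[of "{}"])

lemma eval_power: "mpoly_eval a (p ^ k) = mpoly_eval a p ^ k"
  by (induction k) (simp_all add: eval_one eval_mult)

lemma eval_prod: "mpoly_eval a (\<Prod>x\<in>A. g x) = (\<Prod>x\<in>A. mpoly_eval a (g x))"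
  by (induction A rule: infinite_finite_induct) (auto simp: eval_one eval_mult)

lemma eval_sum_list: "mpoly_eval a (\<Sum>q\<leftarrow>qs. g q) = (\<Sum>q\<leftarrow>qs. mpoly_eval a (g q))"
  by (induction qs) (simp_all add: eval_zero eval_add)

lemmas eval_simps = eval_add eval_uminus eval_diff eval_mult eval_Const eval_Var eval_one
  eval_zero eval_power

lemma eval_subst: "mpoly_eval a (mpoly_subst \<sigma> p) = mpoly_eval (\<lambda>v. mpoly_eval a (\<sigma> v)) p"
  unfolding mpoly_subst_def
  by (simp add: eval_sum eval_prod eval_simps mpoly_eval_def[of _ p])

lemma eval_cong:
  assumes "vars p \<subseteq> V" "\<And>v. v \<in> V \<Longrightarrow> a v = b v"
  shows "mpoly_eval a p = mpoly_eval b p"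
  unfolding mpoly_eval_def
  using assms by (intro sum.cong prod.cong arg_cong2[where f = "(*)"] refl) (auto simp: vars_def)

lemma single_eq_prod_Var:
  "Poly_Mapping.single m c = Const c * (\<Prod>v\<in>Poly_Mapping.keys m. Var v ^ Poly_Mapping.lookup m v)"
proof -
  have pow: "Var v ^ k = Poly_Mapping.single (Poly_Mapping.single v k) 1" for v :: 'a and k
    by (induction k) (simp_all add: Var_def mult_single single_add[symmetric])
  have prod: "(\<Prod>v\<in>K. Poly_Mapping.single (g v) 1) = Poly_Mapping.single (\<Sum>v\<in>K. g v) (1::real)"
    for K :: "'a set" and g :: "'a \<Rightarrow> 'a monom"
    by (induction K rule: infinite_finite_induct) (simp_all add: mult_single)
  have "(\<Sum>v\<in>Poly_Mapping.keys m. Poly_Mapping.single v (Poly_Mapping.lookup m v)) = m"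
    by (rule poly_mapping_eqI) (auto simp: lookup_sum lookup_single when_def in_keys_iff)
  then show ?thesis
    by (simp add: pow prod Const_def mult_single)
qed

lemma mpoly_induct [consumes 1, case_names Const Var add mult]:
  assumes "vars p \<subseteq> V"
    and Const: "\<And>c. P (Const c)"
    and Var: "\<And>v. v \<in> V \<Longrightarrow> P (Var v)"
    and add: "\<And>p q. vars p \<subseteq> V \<Longrightarrow> vars q \<subseteq> V \<Longrightarrow> P p \<Longrightarrow> P q \<Longrightarrow> P (p + q)"
    and mult: "\<And>p q. vars p \<subseteq> V \<Longrightarrow> vars q \<subseteq> V \<Longrightarrow> P p \<Longrightarrow> P q \<Longrightarrow> P (p * q)"
  shows "P p"
proof -
  define Q where "Q p \<longleftrightarrow> vars p \<subseteq> V \<and> P p" for p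
  have one: "Q 1" and zero: "Q 0"
    using Const[of 1] Const[of 0] by (simp_all add: Q_def vars_simps Const_def)
  have Q_add: "Q (p + q)" and Q_mult: "Q (p * q)" if "Q p" "Q q" for p q
    using that add mult vars_closed(3,5)[of p V q] by (simp_all add: Q_def)
  have Q_sum: "Q (\<Sum>x\<in>A. g x)" if "\<And>x. x \<in> A \<Longrightarrow> Q (g x)" for A and g :: "'a monom \<Rightarrow> 'a mpoly"
    using that by (induction A rule: infinite_finite_induct) (auto intro: zero Q_add)
  have Q_prod: "Q (\<Prod>x\<in>A. g x)" if "\<And>x. x \<in> A \<Longrightarrow> Q (g x)" for A and g :: "'a \<Rightarrow> 'a mpoly"
    using that by (induction A rule: infinite_finite_induct) (auto intro: one Q_mult)
  have Q_power: "Q (p ^ k)" if "Q p" for p k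
    using that by (induction k) (auto intro: one Q_mult)
  have "Q (\<Sum>m\<in>Poly_Mapping.keys p. Poly_Mapping.single m (Poly_Mapping.lookup p m))"
  proof (rule Q_sum)
    fix m assume "m \<in> Poly_Mapping.keys p"
    then have "Q (Var v)" if "v \<in> Poly_Mapping.keys m" for v
    proof -
      have "v \<in> V" using that \<open>m \<in> Poly_Mapping.keys p\<close> assms(1) by (auto simp: vars_def)
      then show ?thesis by (simp add: Q_def vars_closed Var)
    qed
    moreover have "Q (Const c)" for c using Const by (simp add: Q_def vars_closed)
    ultimately show "Q (Poly_Mapping.single m (Poly_Mapping.lookup p m))"
      unfolding single_eq_prod_Var by (intro Q_mult Q_prod Q_power)
  qed
  then have "Q p" using mpoly_eq_sum_single[of p] by simp
  then show ?thesis by (simp add: Q_def)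
qed


section \<open>Ideals given by finitely many points\<close>

lemma vanishing_ideal: "ideal {p. vars p \<subseteq> V \<and> (\<forall>a\<in>P. mpoly_eval a p = 0)} (mpoly_ring V)"
proof -
  interpret R: cring "mpoly_ring V" by (rule cring_mpoly_ring)
  have inv: "inv\<^bsub>add_monoid (mpoly_ring V)\<^esub> p = - p" if "vars p \<subseteq> V" for p
    using R.minus_equality[of "- p" p] that
    by (simp add: mpoly_ring_def vars_simps a_inv_def)
  show ?thesis
  proof (rule idealI)
    show "subgroup {p. vars p \<subseteq> V \<and> (\<forall>a\<in>P. mpoly_eval a p = 0)} (add_monoid (mpoly_ring V))"
    proof (rule subgroup.intro)
      fix p assume "p \<in> {p. vars p \<subseteq> V \<and> (\<forall>a\<in>P. mpoly_eval a p = 0)}"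
      then show "inv\<^bsub>add_monoid (mpoly_ring V)\<^esub> p \<in> {p. vars p \<subseteq> V \<and> (\<forall>a\<in>P. mpoly_eval a p = 0)}"
        by (subst inv) (simp_all add: vars_simps eval_simps)
    qed (auto simp: mpoly_ring_def vars_simps(1) eval_simps vars_closed)
  next
    show "ring (mpoly_ring V)" by (rule R.ring_axioms)
  qed (simp_all add: mpoly_ring_def eval_simps vars_closed)
qed

lemma ideal_closed:
  assumes "ideal J (mpoly_ring V)"
  shows "p \<in> J \<Longrightarrow> vars p \<subseteq> V"
    and "0 \<in> J"
    and "p \<in> J \<Longrightarrow> q \<in> J \<Longrightarrow> p + q \<in> J"
    and "p \<in> J \<Longrightarrow> vars r \<subseteq> V \<Longrightarrow> r * p \<in> J"
    and "(\<And>x. x \<in> A \<Longrightarrow> g x \<in> J) \<Longrightarrow> (\<Sum>x\<in>A. g x) \<in> J"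
proof -
  interpret ideal J "mpoly_ring V" by (rule assms)
  show zero: "0 \<in> J"
    using additive_subgroup.zero_closed[OF additive_subgroup_axioms] by (simp add: mpoly_ring_def)
  show "p \<in> J \<Longrightarrow> vars p \<subseteq> V"
    using a_subset by (auto simp: mpoly_ring_def)
  show add: "p \<in> J \<Longrightarrow> q \<in> J \<Longrightarrow> p + q \<in> J" for p q
    using additive_subgroup.a_closed[OF additive_subgroup_axioms, of p q] by (simp add: mpoly_ring_def)
  show "p \<in> J \<Longrightarrow> vars r \<subseteq> V \<Longrightarrow> r * p \<in> J"
    using I_l_closed[of p r] by (simp add: mpoly_ring_def)
  show "(\<And>x. x \<in> A \<Longrightarrow> g x \<in> J) \<Longrightarrow> (\<Sum>x\<in>A. g x) \<in> J"
    by (induction A rule: infinite_finite_induct) (auto intro: zero add)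
qed

text \<open>
  Modulo \<open>J\<close>, the factor \<open>e\<close> is supported at the single point \<open>a\<close>: multiplying by \<open>e\<close> turns every
  polynomial into its value there.
\<close>

lemma ideal_localize:
  assumes J: "ideal J (mpoly_ring V)" and "W \<subseteq> V" and "vars p \<subseteq> W"
    and Var: "\<And>v. v \<in> W \<Longrightarrow> (Var v - Const (a v)) * e \<in> J"
  shows "(p - Const (mpoly_eval a p)) * e \<in> J"
  using assms(3)
proof (induction p rule: mpoly_induct)
  case (Const c)
  then show ?case using ideal_closed(2)[OF J] by (simp add: eval_Const mult_zero_left)
next
  case (Var v)
  then show ?case using assms(4) by (simp add: eval_Var)
next
  case (add p q)
  have "(p + q - Const (mpoly_eval a (p + q))) * e =
      (p - Const (mpoly_eval a p)) * e + (q - Const (mpoly_eval a q)) * e"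
    by (simp add: eval_add Const_def single_add algebra_simps)
  then show ?case using ideal_closed(3)[OF J] add by simp
next
  case (mult p q)
  have "(p * q - Const (mpoly_eval a (p * q))) * e =
      p * ((q - Const (mpoly_eval a q)) * e)
      + Const (mpoly_eval a q) * ((p - Const (mpoly_eval a p)) * e)"
    by (simp add: eval_mult Const_def mult_single algebra_simps)
  also have "\<dots> \<in> J"
  proof (rule ideal_closed(3)[OF J])
    show "p * ((q - Const (mpoly_eval a q)) * e) \<in> J"
      using mult \<open>W \<subseteq> V\<close> by (intro ideal_closed(4)[OF J mult.IH(2)]) auto
    show "Const (mpoly_eval a q) * ((p - Const (mpoly_eval a p)) * e) \<in> J"
      by (intro ideal_closed(4)[OF J mult.IH(1)] vars_closed)
  qed
  finally show ?case .
qed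

text \<open>
  A Nullstellensatz for ideals in which the variables in \<open>W\<close> are idempotent and every variable
  \<open>v\<close> is congruent to a polynomial \<open>h v\<close> in the variables of \<open>W\<close>.  The products \<open>\<delta> T\<close> below,
  one for each 0/1-assignment of \<open>W\<close>, add up to \<open>1\<close>, and each of them is supported modulo the
  ideal at the point that \<open>T\<close> determines.  So \<open>p\<close> is congruent to the sum of its values times
  the \<open>\<delta> T\<close>.  The element \<open>0\<close> is inserted so that \<open>h v\<close> may be \<open>v\<close> itself.
\<close>

lemma mpoly_ideal_eq_vanishing:
  fixes h :: "'v \<Rightarrow> 'v mpoly"
  defines "pt \<equiv> \<lambda>T v. mpoly_eval (indicator T) (h v)"
  assumes "finite W" "W \<subseteq> V" "\<And>b. b \<in> B \<Longrightarrow> vars b \<subseteq> V"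
    and idem: "\<And>v. v \<in> W \<Longrightarrow> Var v ^ 2 - Var v \<in> B"
    and h: "\<And>v. v \<in> V \<Longrightarrow> vars (h v) \<subseteq> W"
      "\<And>v. v \<in> V \<Longrightarrow> h v - Var v \<in> insert 0 B"
    and van: "\<And>b T. b \<in> B \<Longrightarrow> T \<subseteq> W \<Longrightarrow> mpoly_eval (pt T) b = 0"
  shows "mpoly_ideal V B = {p. vars p \<subseteq> V \<and> (\<forall>T. T \<subseteq> W \<longrightarrow> mpoly_eval (pt T) p = 0)}"
proof -
  interpret R: cring "mpoly_ring V" by (rule cring_mpoly_ring)
  define J where "J = mpoly_ideal V B"
  have B: "B \<subseteq> carrier (mpoly_ring V)" using assms(4) by (auto simp: mpoly_ring_def)
  have J: "ideal J (mpoly_ring V)"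
    unfolding J_def mpoly_ideal_def by (rule R.genideal_ideal[OF B])
  have BJ: "insert 0 B \<subseteq> J"
    using R.genideal_self[OF B] ideal_closed(2)[OF J] by (auto simp: J_def mpoly_ideal_def)
  have "p \<in> J" if p: "vars p \<subseteq> V" "\<And>T. T \<subseteq> W \<Longrightarrow> mpoly_eval (pt T) p = 0" for p
  proof -
    define \<delta> :: "'v set \<Rightarrow> 'v mpoly" where
      "\<delta> T = (\<Prod>v\<in>T. Var v) * (\<Prod>v\<in>W - T. 1 - Var v)" for T
    have part: "(\<Sum>T\<in>Pow W. \<delta> T) = 1"
      using prod_add[OF \<open>finite W\<close>, of Var "\<lambda>v. 1 - Var v"] by (simp add: \<delta>_def)
    have "p * \<delta> T \<in> J" if T: "T \<subseteq> W" for T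
    proof -
      have fT: "finite T" using T \<open>finite W\<close> finite_subset by blast
      have on_W: "(Var v - Const (indicator T v)) * \<delta> T \<in> J" if v: "v \<in> W" for v
      proof -
        have "\<exists>r. vars r \<subseteq> V \<and> (Var v - Const (indicator T v)) * \<delta> T = r * (Var v ^ 2 - Var v)"
        proof (cases "v \<in> T")
          case True
          define r where "r = (\<Prod>v\<in>T - {v}. Var v) * (\<Prod>v\<in>W - T. 1 - Var v :: 'v mpoly)"
          have "\<delta> T = Var v * r"
            using prod.remove[OF fT True, of Var] by (simp add: \<delta>_def r_def mult.assoc)
          moreover have "vars r \<subseteq> V"
            unfolding r_def using T \<open>W \<subseteq> V\<close> by (intro vars_closed) (auto simp: vars_simps)
          ultimately show ?thesis
            using True by (intro exI[of _ r]) (simp add: Const_def power2_eq_square algebra_simps)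
        next
          case False
          define r where "r = (\<Prod>v\<in>T. Var v) * (\<Prod>v\<in>W - T - {v}. 1 - Var v :: 'v mpoly)"
          have "\<delta> T = (1 - Var v) * r"
            using prod.remove[of "W - T" v "\<lambda>v. 1 - Var v"] \<open>finite W\<close> False v
            by (simp add: \<delta>_def r_def mult_ac)
          moreover have "vars (- r) \<subseteq> V"
            unfolding r_def vars_simps using T \<open>W \<subseteq> V\<close>
            by (intro vars_closed) (auto simp: vars_simps)
          ultimately show ?thesis
            using False
            by (intro exI[of _ "- r"]) (simp add: Const_def power2_eq_square ring_distribs mult_ac)
        qed
        then show ?thesis using ideal_closed(4)[OF J] idem[OF v] BJ by fastforce
      qed
      have \<delta>V: "vars (\<delta> T) \<subseteq> V"
        unfolding \<delta>_def using T \<open>W \<subseteq> V\<close> by (intro vars_closed) (auto simp: vars_simps)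
      have "(Var v - Const (pt T v)) * \<delta> T \<in> J" if v: "v \<in> V" for v
      proof -
        have "(h v - Const (pt T v)) * \<delta> T \<in> J"
          unfolding pt_def using ideal_localize[OF J \<open>W \<subseteq> V\<close> h(1)[OF v] on_W] by simp
        moreover have "(- \<delta> T) * (h v - Var v) \<in> J"
          using h(2)[OF v] BJ \<delta>V by (intro ideal_closed(4)[OF J]) (auto simp: vars_simps)
        ultimately have "(h v - Const (pt T v)) * \<delta> T + (- \<delta> T) * (h v - Var v) \<in> J"
          by (rule ideal_closed(3)[OF J])
        then show ?thesis by (simp add: algebra_simps)
      qed
      from ideal_localize[OF J subset_refl p(1) this] show ?thesis
        using p(2)[OF T] by (simp add: Const_def)
    qed
    then have "(\<Sum>T\<in>Pow W. p * \<delta> T) \<in> J"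
      by (intro ideal_closed(5)[OF J]) auto
    then show ?thesis by (simp add: sum_distrib_left[symmetric] part)
  qed
  moreover have "J \<subseteq> {p. vars p \<subseteq> V \<and> (\<forall>a\<in>pt ` Pow W. mpoly_eval a p = 0)}"
    unfolding J_def mpoly_ideal_def
    by (rule R.genideal_minimal[OF vanishing_ideal]) (use assms(4) van in auto)
  ultimately show ?thesis by (auto simp: J_def)
qed

lemma I2_eq_vanishing:
  assumes "finite V"
  shows "I2 V = {p. vars p \<subseteq> V \<and> (\<forall>a\<in>indicator ` Pow V. mpoly_eval a p = 0)}"
proof -
  have "I2 V = {p. vars p \<subseteq> V \<and>
      (\<forall>T. T \<subseteq> V \<longrightarrow> mpoly_eval (\<lambda>v. mpoly_eval (indicator T) (Var v)) p = 0)}"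
    unfolding I2_def using assms
    by (intro mpoly_ideal_eq_vanishing)
      (auto simp: eval_simps indicator_def intro!: vars_closed(2,4,6) del: subsetI)
  then show ?thesis by (auto simp: eval_Var)
qed

text \<open>The zeros of \<open>I0 n\<close>: the pairs of subsets, with the \<open>s\<close>-variables describing the intersection.\<close>

primrec pair_point :: "nat set \<Rightarrow> nat set \<Rightarrow> xys \<Rightarrow> real" where
  "pair_point A B (Xv i) = indicator A i"
| "pair_point A B (Yv i) = indicator B i"
| "pair_point A B (Sv i) = indicator (A \<inter> B) i"

definition pair_points :: "nat \<Rightarrow> (xys \<Rightarrow> real) set" where
  "pair_points n = (\<lambda>(A, B). pair_point A B) ` (Pow {1..n} \<times> Pow {1..n})"

lemma pair_pointsI: "A \<subseteq> {1..n} \<Longrightarrow> B \<subseteq> {1..n} \<Longrightarrow> pair_point A B \<in> pair_points n"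
  by (auto simp: pair_points_def)

lemma pair_pointsE:
  assumes "a \<in> pair_points n"
  obtains A B where "A \<subseteq> {1..n}" "B \<subseteq> {1..n}" "a = pair_point A B"
  using assms by (auto simp: pair_points_def)

primrec xy_form :: "xys \<Rightarrow> xys mpoly" where
  "xy_form (Xv i) = Var (Xv i)"
| "xy_form (Yv i) = Var (Yv i)"
| "xy_form (Sv i) = Var (Xv i) * Var (Yv i)"

lemma eval_xy_form:
  "mpoly_eval (indicator T) (xy_form v) = pair_point {i. Xv i \<in> T} {i. Yv i \<in> T} v"
  by (cases v) (auto simp: eval_simps indicator_def)

lemma I0_eq_vanishing:
  "I0 n = {p. vars p \<subseteq> xys_vars n \<and> (\<forall>a\<in>pair_points n. mpoly_eval a p = 0)}"
proof -
  let ?W = "Xv ` {1..n} \<union> Yv ` {1..n}"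
  let ?pt = "\<lambda>T. pair_point {i. Xv i \<in> T} {i. Yv i \<in> T}"
  have "I0 n = {p. vars p \<subseteq> xys_vars n \<and>
      (\<forall>T. T \<subseteq> ?W \<longrightarrow> mpoly_eval (\<lambda>v. mpoly_eval (indicator T) (xy_form v)) p = 0)}"
    unfolding I0_def
  proof (rule mpoly_ideal_eq_vanishing)
    fix v assume "v \<in> xys_vars n"
    then show "vars (xy_form v) \<subseteq> ?W"
      by (auto simp: xys_vars_def intro!: vars_closed del: subsetI)
  next
    fix b T assume b: "b \<in> (\<Union>i\<in>{1..n}.
        {Var (Xv i) ^ 2 - Var (Xv i), Var (Xv i) * Var (Yv i) - Var (Sv i),
         Var (Xv i) * Var (Sv i) - Var (Sv i), Var (Yv i) ^ 2 - Var (Yv i),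
         Var (Yv i) * Var (Sv i) - Var (Sv i), Var (Sv i) ^ 2 - Var (Sv i)})"
    then show "vars b \<subseteq> xys_vars n"
      by (auto simp: xys_vars_def intro!: vars_closed del: subsetI)
    show "mpoly_eval (\<lambda>v. mpoly_eval (indicator T) (xy_form v)) b = 0"
      using b unfolding eval_xy_form by (auto simp: eval_simps indicator_def)
  next
    fix v assume "v \<in> xys_vars n"
    then show "xy_form v - Var v \<in> insert 0 (\<Union>i\<in>{1..n}.
        {Var (Xv i) ^ 2 - Var (Xv i), Var (Xv i) * Var (Yv i) - Var (Sv i),
         Var (Xv i) * Var (Sv i) - Var (Sv i), Var (Yv i) ^ 2 - Var (Yv i),
         Var (Yv i) * Var (Sv i) - Var (Sv i), Var (Sv i) ^ 2 - Var (Sv i)})"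
      by (cases v) (auto simp: xys_vars_def)
  qed (auto simp: xys_vars_def)
  moreover have "?pt ` Pow ?W = pair_points n"
  proof
    show "pair_points n \<subseteq> ?pt ` Pow ?W"
    proof (clarsimp simp: pair_points_def)
      fix A B assume "A \<subseteq> {Suc 0..n}" "B \<subseteq> {Suc 0..n}"
      then show "pair_point A B \<in> ?pt ` Pow (Xv ` {Suc 0..n} \<union> Yv ` {Suc 0..n})"
        by (intro image_eqI[of _ _ "Xv ` A \<union> Yv ` B"]) (auto simp: image_iff)
    qed
  qed (auto simp: pair_points_def)
  ultimately show ?thesis
    unfolding eval_xy_form
    by (simp flip: \<open>?pt ` Pow ?W = pair_points n\<close>, simp add: Ball_def)
qed


section \<open>Sums of squares of values\<close>

definition sos_values ::
  "'v set \<Rightarrow> nat \<Rightarrow> ('v \<Rightarrow> real) set \<Rightarrow> (('v \<Rightarrow> real) \<Rightarrow> real) \<Rightarrow> bool" where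
  "sos_values V t P h \<longleftrightarrow>
     (\<exists>qs. set qs \<subseteq> polys_le V t \<and> (\<forall>a\<in>P. h a = (\<Sum>q\<leftarrow>qs. (mpoly_eval a q)\<^sup>2)))"

text \<open>Modulo a vanishing ideal, only the values at the points matter.\<close>

lemma sos_modulo_iff_values:
  assumes I: "I = {p. vars p \<subseteq> V \<and> (\<forall>a\<in>P. mpoly_eval a p = 0)}" and p: "vars p \<subseteq> V"
  shows "sos_modulo V t I p \<longleftrightarrow> sos_values V t P (\<lambda>a. mpoly_eval a p)"
proof -
  have sum_vars: "vars (\<Sum>q\<leftarrow>qs. q ^ 2) \<subseteq> V" if "\<And>q. q \<in> set qs \<Longrightarrow> vars q \<subseteq> V" for qs
    using that by (induction qs) (simp_all add: vars_simps vars_closed)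
  show ?thesis
    unfolding sos_modulo_def sos_values_def I
  proof (intro ex_cong1)
    fix qs
    show "((\<forall>q\<in>set qs. q \<in> carrier (mpoly_ring V) \<and> total_degree q \<le> t) \<and>
        p - (\<Sum>q\<leftarrow>qs. q ^ 2) \<in> {p. vars p \<subseteq> V \<and> (\<forall>a\<in>P. mpoly_eval a p = 0)}) \<longleftrightarrow>
      (set qs \<subseteq> polys_le V t \<and> (\<forall>a\<in>P. mpoly_eval a p = (\<Sum>q\<leftarrow>qs. (mpoly_eval a q)\<^sup>2)))"
    proof (cases "\<forall>q\<in>set qs. vars q \<subseteq> V")
      case True
      then have "vars (p - (\<Sum>q\<leftarrow>qs. q ^ 2)) \<subseteq> V" using p by (intro vars_closed(4) sum_vars) auto
      then show ?thesis
        using True by (auto simp: mpoly_ring_def polys_le_def eval_diff eval_sum_list eval_power)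
    qed (auto simp: mpoly_ring_def polys_le_def)
  qed
qed

lemma sos_values_sum:
  assumes "\<And>k. k \<in> K \<Longrightarrow> sos_values V t P (h k)"
  shows "sos_values V t P (\<lambda>a. \<Sum>k\<in>K. h k a)"
  using assms
proof (induction K rule: infinite_finite_induct)
  case (insert k K)
  obtain qs where qs: "set qs \<subseteq> polys_le V t" "\<forall>a\<in>P. h k a = (\<Sum>q\<leftarrow>qs. (mpoly_eval a q)\<^sup>2)"
    using insert.prems[of k] unfolding sos_values_def by auto
  obtain rs where rs: "set rs \<subseteq> polys_le V t"
      "\<forall>a\<in>P. (\<Sum>k\<in>K. h k a) = (\<Sum>q\<leftarrow>rs. (mpoly_eval a q)\<^sup>2)"
    using insert unfolding sos_values_def by auto
  show ?case
    unfolding sos_values_def using qs rs insert.hyps by (intro exI[of _ "qs @ rs"]) simp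
qed (auto simp: sos_values_def intro: exI[of _ "[]"])

text \<open>
  Sums of squares are stable under an affine change of variables followed by multiplication by
  a square.
\<close>

lemma sos_values_pullback:
  assumes sos: "sos_values V t P (\<lambda>a. mpoly_eval a p)" and p: "vars p \<subseteq> V"
    and \<sigma>: "\<And>v. v \<in> V \<Longrightarrow> \<sigma> v \<in> polys_le W 1" and r: "r \<in> polys_le W d"
    and pts: "\<And>b. b \<in> Q \<Longrightarrow> \<exists>a\<in>P. \<forall>v\<in>V. mpoly_eval b (\<sigma> v) = a v"
  shows "sos_values W (t + d) Q (\<lambda>b. (mpoly_eval b r)\<^sup>2 * mpoly_eval b (mpoly_subst \<sigma> p))"
proof -
  obtain qs where qs: "set qs \<subseteq> polys_le V t"
      "\<And>a. a \<in> P \<Longrightarrow> mpoly_eval a p = (\<Sum>q\<leftarrow>qs. (mpoly_eval a q)\<^sup>2)"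
    using sos unfolding sos_values_def by blast
  let ?rs = "map (\<lambda>q. mpoly_subst \<sigma> q * r) qs"
  have "set ?rs \<subseteq> polys_le W (t + d)"
    using qs(1) \<sigma> r by (auto intro!: polys_le_mult polys_le_subst)
  moreover have "(mpoly_eval b r)\<^sup>2 * mpoly_eval b (mpoly_subst \<sigma> p) =
      (\<Sum>q\<leftarrow>?rs. (mpoly_eval b q)\<^sup>2)" if b: "b \<in> Q" for b
  proof -
    obtain a where a: "a \<in> P" "\<And>v. v \<in> V \<Longrightarrow> mpoly_eval b (\<sigma> v) = a v"
      using pts[OF b] by blast
    have pull: "mpoly_eval b (mpoly_subst \<sigma> q) = mpoly_eval a q" if "vars q \<subseteq> V" for q
      unfolding eval_subst by (rule eval_cong[OF that a(2)])
    have "(\<Sum>q\<leftarrow>?rs. (mpoly_eval b q)\<^sup>2) = (\<Sum>q\<leftarrow>qs. (mpoly_eval b r)\<^sup>2 * (mpoly_eval a q)\<^sup>2)"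
      using qs(1) by (auto simp: eval_mult power_mult_distrib mult.commute
          pull[OF polys_le_vars[OF subsetD[OF qs(1)]]] intro!: arg_cong[where f = sum_list])
    then show ?thesis
      by (simp add: pull[OF p] qs(2)[OF a(1)] sum_list_const_mult)
  qed
  ultimately show ?thesis unfolding sos_values_def by blast
qed


section \<open>Derivatives and discrete differences\<close>

lemma keys_deriv:
  "Poly_Mapping.keys (mpoly_deriv v p) \<subseteq>
    (\<lambda>m. m - Poly_Mapping.single v 1) ` {m \<in> Poly_Mapping.keys p. Poly_Mapping.lookup m v \<noteq> 0}"
  unfolding mpoly_deriv_def
  by (rule order_trans[OF keys_sum]) (auto split: if_splits)

lemma multilinear_deriv:
  assumes "multilinear p"
  shows "multilinear (mpoly_deriv v p)"
  unfolding multilinear_def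
proof (intro ballI allI)
  fix m w assume "m \<in> Poly_Mapping.keys (mpoly_deriv v p)"
  then obtain m' where "m' \<in> Poly_Mapping.keys p" "m = m' - Poly_Mapping.single v 1"
    using keys_deriv[of v p] by blast
  then show "Poly_Mapping.lookup m w \<le> 1"
    using assms by (auto simp: multilinear_def lookup_minus intro: diff_le_self order_trans)
qed

lemma vars_deriv_multilinear:
  assumes "multilinear p"
  shows "vars (mpoly_deriv v p) \<subseteq> vars p - {v}"
proof
  fix w assume "w \<in> vars (mpoly_deriv v p)"
  then obtain m where m: "m \<in> Poly_Mapping.keys p" "w \<in> Poly_Mapping.keys (m - Poly_Mapping.single v 1)"
    using keys_deriv[of v p] unfolding vars_def by blast
  moreover have "Poly_Mapping.lookup m v \<le> 1"
    using assms m(1) by (simp add: multilinear_def)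
  ultimately show "w \<in> vars p - {v}"
    by (auto simp: vars_def in_keys_iff lookup_minus lookup_single when_def split: if_splits)
qed

text \<open>A polynomial that is affine in \<open>v\<close> has a difference quotient equal to its derivative.\<close>

lemma eval_deriv_multilinear:
  assumes "multilinear p"
  shows "mpoly_eval a (mpoly_deriv v p) = mpoly_eval (a(v := 1)) p - mpoly_eval (a(v := 0)) p"
proof -
  have "real (Poly_Mapping.lookup m v) * monom_value a (m - Poly_Mapping.single v 1) =
      monom_value (a(v := 1)) m - monom_value (a(v := 0)) m"
    if m: "m \<in> Poly_Mapping.keys p" for m
  proof -
    have indep: "monom_value (a(v := c)) m' = monom_value a m'"
      if "v \<notin> Poly_Mapping.keys m'" for c m'
      unfolding monom_value_def using that by (intro prod.cong) auto
    have "Poly_Mapping.lookup m v \<le> 1" using assms m by (simp add: multilinear_def)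
    then consider "Poly_Mapping.lookup m v = 0" | "Poly_Mapping.lookup m v = 1" by linarith
    then show ?thesis
    proof cases
      case 1
      then show ?thesis using indep[of m] by (simp add: in_keys_iff)
    next
      case 2
      define m' where "m' = m - Poly_Mapping.single v 1"
      have m_eq: "m = m' + Poly_Mapping.single v 1"
        using 2 by (intro poly_mapping_eqI)
          (auto simp: m'_def lookup_add lookup_minus lookup_single when_def)
      have "v \<notin> Poly_Mapping.keys m'"
        using 2 by (simp add: m'_def in_keys_iff lookup_minus)
      moreover have "monom_value b (Poly_Mapping.single v 1) = b v" for b :: "'a \<Rightarrow> real"
        by (simp add: monom_value_def)
      ultimately have "monom_value (a(v := c)) m = monom_value a m' * c" for c
        unfolding m_eq monom_value_add by (simp add: indep)
      then show ?thesis using 2 by (simp add: m'_def)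
    qed
  qed
  then show ?thesis
    unfolding mpoly_deriv_def
    by (simp add: eval_sum eval_single eval_monom_value[of _ p] mult.assoc
        right_diff_distrib sum_subtractf del: fun_upd_apply)
qed

definition second_diff :: "(nat set \<Rightarrow> real) \<Rightarrow> nat \<Rightarrow> nat \<Rightarrow> nat set \<Rightarrow> real" where
  "second_diff f i j S = f (insert i (insert j S)) - f (insert i S) - f (insert j S) + f S"

lemma MLE_props:
  "vars (MLE n f) \<subseteq> {1..n}" "multilinear (MLE n f)"
  "S \<subseteq> {1..n} \<Longrightarrow> mpoly_eval (indicator S) (MLE n f) = f S"
  using is_MLE_MLE[of n f] by (auto simp: is_MLE_def mpoly_ring_def)

lemma vars_second_deriv_MLE:
  "vars (- mpoly_deriv i (mpoly_deriv j (MLE n f))) \<subseteq> {1..n} - {i, j}"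
  using vars_deriv_multilinear[of "mpoly_deriv j (MLE n f)" i]
    vars_deriv_multilinear[of "MLE n f" j] multilinear_deriv[of "MLE n f" j] MLE_props(1,2)[of n f]
  by (auto simp: vars_simps)

lemma eval_second_deriv_MLE:
  assumes "i \<in> {1..n}" "j \<in> {1..n}" "i \<noteq> j" "S \<subseteq> {1..n} - {i, j}"
  shows "mpoly_eval (indicator S) (mpoly_deriv i (mpoly_deriv j (MLE n f))) = second_diff f i j S"
proof -
  have upd: "(indicator T)(v := 1) = (indicator (insert v T) :: nat \<Rightarrow> real)"
    "v \<notin> T \<Longrightarrow> (indicator T)(v := 0) = (indicator T :: nat \<Rightarrow> real)" for T and v :: nat
    by (auto simp: indicator_def)
  have "j \<notin> insert i S" "j \<notin> S" "i \<notin> S" using assms by auto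
  then show ?thesis
    using assms
    by (simp add: eval_deriv_multilinear multilinear_deriv MLE_props upd second_diff_def insert_commute
        subset_Diff_insert subset_insertI2)
qed

lemma sum_telescope_insert:
  fixes g :: "nat set \<Rightarrow> real"
  assumes "finite C"
  shows "(\<Sum>i\<in>C. g (insert i {k \<in> C. k < i}) - g {k \<in> C. k < i}) = g C - g {}"
  using assms
proof (induction C rule: finite_linorder_max_induct)
  case (insert b C)
  have "{k \<in> insert b C. k < i} = {k \<in> C. k < i}" if "i \<in> C" for i
    using insert.hyps that by (auto dest: less_asym)
  moreover have "{k \<in> insert b C. k < b} = C" using insert.hyps by auto
  moreover have "b \<notin> C" using insert.hyps by blast
  ultimately show ?case using insert by simp
qed simp

definition stage :: "nat set \<Rightarrow> nat set \<Rightarrow> nat \<Rightarrow> nat \<Rightarrow> nat set" where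
  "stage A B i j = (A \<inter> B) \<union> {k \<in> A - B. k < i} \<union> {k \<in> B - A. k < j}"

text \<open>
  Adding the elements of \<open>A - B\<close> and of \<open>B - A\<close> to \<open>A \<inter> B\<close> one at a time, in increasing order,
  telescopes the defect of submodularity into second differences.
\<close>

lemma submodularity_defect:
  assumes "finite A" "finite B"
  shows "f A + f B - f (A \<union> B) - f (A \<inter> B) =
    (\<Sum>i\<in>A - B. \<Sum>j\<in>B - A. - second_diff f i j (stage A B i j))"
proof -
  let ?S = "A \<inter> B" and ?C = "\<lambda>i. {k \<in> A - B. k < i}"
  have inner: "(\<Sum>j\<in>B - A. second_diff f i j (stage A B i j)) =
      (f (?S \<union> insert i (?C i) \<union> (B - A)) - f (?S \<union> ?C i \<union> (B - A)))
      - (f (?S \<union> insert i (?C i)) - f (?S \<union> ?C i))" for i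
    using sum_telescope_insert[of "B - A"
        "\<lambda>X. f (?S \<union> insert i (?C i) \<union> X) - f (?S \<union> ?C i \<union> X)"] assms(2)
    by (simp add: second_diff_def stage_def insert_commute algebra_simps)
  have union: "?S \<union> (A - B) \<union> (B - A) = A \<union> B" "?S \<union> (B - A) = B" "?S \<union> (A - B) = A"
    by auto
  have "(\<Sum>i\<in>A - B. \<Sum>j\<in>B - A. second_diff f i j (stage A B i j)) =
      (f (A \<union> B) - f A) - (f B - f ?S)"
    unfolding inner
    using sum_telescope_insert[of "A - B" "\<lambda>X. f (?S \<union> X \<union> (B - A)) - f (?S \<union> X)"] assms(1) union
    by (simp add: algebra_simps)
  then show ?thesis by (simp add: sum_negf)
qed

text \<open>
  On \<open>pair_points n\<close>, membership in a stage is affine in \<open>x\<close>, \<open>y\<close>, \<open>s\<close>: below both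
  thresholds it is membership in \<open>A \<union> B\<close>, below only one of them membership in \<open>A\<close> or in
  \<open>B\<close>, and otherwise membership in \<open>A \<inter> B\<close>.
\<close>

definition stage_form :: "nat \<Rightarrow> nat \<Rightarrow> nat \<Rightarrow> xys mpoly" where
  "stage_form i j k =
     (if k < i then (if k < j then Var (Xv k) + Var (Yv k) - Var (Sv k) else Var (Xv k))
      else (if k < j then Var (Yv k) else Var (Sv k)))"

lemma eval_stage_form: "mpoly_eval (pair_point A B) (stage_form i j k) = indicator (stage A B i j) k"
  by (auto simp: stage_form_def stage_def eval_simps indicator_def)

lemma polys_le_xys:
  assumes "k \<in> {1..n}"
  shows "Var (Xv k) \<in> polys_le (xys_vars n) 1" "Var (Yv k) \<in> polys_le (xys_vars n) 1"
    "Var (Sv k) \<in> polys_le (xys_vars n) 1"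
  using assms polys_le_Var[of _ "xys_vars n"] by (auto simp: xys_vars_def)


section \<open>Mixed differences of polynomials in x, y, s\<close>

primrec xys_index :: "xys \<Rightarrow> nat" where
  "xys_index (Xv i) = i"
| "xys_index (Yv i) = i"
| "xys_index (Sv i) = i"

definition mixed_diff :: "((xys \<Rightarrow> real) \<Rightarrow> real) \<Rightarrow> nat \<Rightarrow> nat \<Rightarrow> nat set \<Rightarrow> real" where
  "mixed_diff g i j S =
     g (pair_point (insert i S) (insert j S)) - g (pair_point (insert i S) S)
     - g (pair_point S (insert j S)) + g (pair_point S S)"

text \<open>
  A monomial is a product of a part with index \<open>i\<close>, a part with index \<open>j\<close> and a rest, so its
  mixed difference is a constant times the rest.  The constant is zero unless both indices occur,
  and then they take away at least \<open>2\<close> of the degree.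
\<close>

lemma mixed_diff_monom:
  assumes m: "Poly_Mapping.keys m \<subseteq> xys_vars n" "monom_degree m \<le> t + 2" and "i \<noteq> j"
  shows "\<exists>r\<in>polys_le ({1..n} - {i, j}) t. \<forall>S. S \<subseteq> {1..n} - {i, j} \<longrightarrow>
    mpoly_eval (indicator S) r = mixed_diff (\<lambda>a. monom_value a m) i j S"
proof -
  define e where "e = Poly_Mapping.lookup m"
  define K where "K k = {v \<in> Poly_Mapping.keys m. xys_index v = k}" for k
  define R where "R = {v \<in> Poly_Mapping.keys m. xys_index v \<noteq> i \<and> xys_index v \<noteq> j}"
  define val where "val L a = (\<Prod>v\<in>L. a v ^ e v)" for L and a :: "xys \<Rightarrow> real"
  define c where "c = (val (K i) (pair_point {i} {}) - val (K i) (pair_point {} {}))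
    * (val (K j) (pair_point {} {j}) - val (K j) (pair_point {} {}))"
  define r where "r = Const c * (\<Prod>v\<in>R. Var (xys_index v) ^ e v)"
  have keys: "Poly_Mapping.keys m = K i \<union> K j \<union> R" and fin: "finite (K i)" "finite (K j)" "finite R"
    and disj: "K i \<inter> K j = {}" "(K i \<union> K j) \<inter> R = {}"
    using \<open>i \<noteq> j\<close> by (auto simp: K_def R_def)
  have factor: "monom_value a m = val (K i) a * val (K j) a * val R a" for a
    unfolding monom_value_def keys val_def e_def using fin disj
    by (simp add: prod.union_disjoint)
  have deg: "(\<Sum>v\<in>K i. e v) + (\<Sum>v\<in>K j. e v) + (\<Sum>v\<in>R. e v) \<le> t + 2"
    using m(2) unfolding monom_degree_def keys e_def using fin disj
    by (simp add: sum.union_disjoint)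
  have "r \<in> polys_le ({1..n} - {i, j}) t"
  proof (cases "K i = {} \<or> K j = {}")
    case True
    then have "r = 0" by (auto simp: r_def c_def val_def Const_def)
    then show ?thesis by (simp add: polys_le_zero)
  next
    case False
    have pos: "0 < (\<Sum>v\<in>K k. e v)" if ne: "K k \<noteq> {}" for k
    proof -
      have "finite (K k)" by (simp add: K_def)
      moreover obtain v where "v \<in> K k" using ne by blast
      moreover from this have "0 < e v" by (simp add: K_def e_def in_keys_iff)
      ultimately show ?thesis by (intro sum_pos2) auto
    qed
    have "(\<Sum>v\<in>R. e v) \<le> t"
      using deg pos[of i] pos[of j] False by linarith
    moreover have "Var (xys_index v) \<in> polys_le ({1..n} - {i, j}) 1" if "v \<in> R" for v
      using that m(1) by (intro polys_le_Var) (auto simp: R_def xys_vars_def)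
    ultimately show ?thesis
      unfolding r_def
      by (intro polys_le_Const_mult polys_le_mono[OF polys_le_prod_power]) auto
  qed
  moreover have "mpoly_eval (indicator S) r = mixed_diff (\<lambda>a. monom_value a m) i j S"
    if "S \<subseteq> {1..n} - {i, j}" for S
  proof -
    have S: "i \<notin> S" "j \<notin> S" using that by auto
    have val_local: "val L (pair_point A B) = val L (pair_point A' B')"
      if "\<And>v. v \<in> L \<Longrightarrow> (xys_index v \<in> A \<longleftrightarrow> xys_index v \<in> A') \<and> (xys_index v \<in> B \<longleftrightarrow> xys_index v \<in> B')"
      for L A B A' B'
      unfolding val_def
    proof (rule prod.cong[OF refl])
      fix v assume "v \<in> L"
      then show "pair_point A B v ^ e v = pair_point A' B' v ^ e v"
        using that[of v] by (cases v) (auto simp: indicator_def)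
    qed
    \<comment> \<open>a variable only sees whether its own index belongs to the two sets\<close>
    have rest: "val R (pair_point A B) = val R (pair_point S S)"
      if "A \<in> {S, insert i S}" "B \<in> {S, insert j S}" for A B
      using that by (intro val_local) (auto simp: R_def)
    have at_i: "val (K i) (pair_point (insert i S) B) = val (K i) (pair_point {i} {})"
      "val (K i) (pair_point S B) = val (K i) (pair_point {} {})" if "B \<in> {S, insert j S}" for B
      using that S \<open>i \<noteq> j\<close> by (auto intro!: val_local simp: K_def)
    have at_j: "val (K j) (pair_point A (insert j S)) = val (K j) (pair_point {} {j})"
      "val (K j) (pair_point A S) = val (K j) (pair_point {} {})" if "A \<in> {S, insert i S}" for A
      using that S \<open>i \<noteq> j\<close> by (auto intro!: val_local simp: K_def)
    have diag: "pair_point S S v = indicator S (xys_index v)" for v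
      by (cases v) auto
    have "mpoly_eval (indicator S) r = c * val R (pair_point S S)"
      by (simp add: r_def eval_simps eval_prod val_def diag)
    moreover have "mixed_diff (\<lambda>a. monom_value a m) i j S = c * val R (pair_point S S)"
      using rest[of "insert i S" "insert j S"] rest[of "insert i S" S] rest[of S "insert j S"]
        at_i[of S] at_i[of "insert j S"] at_j[of S] at_j[of "insert i S"]
      by (simp add: mixed_diff_def factor c_def ring_distribs)
    ultimately show ?thesis by simp
  qed
  ultimately show ?thesis by blast
qed

lemma mixed_diff_poly:
  assumes q: "q \<in> polys_le (xys_vars n) (t + 2)" and "i \<noteq> j"
  shows "\<exists>r\<in>polys_le ({1..n} - {i, j}) t. \<forall>S. S \<subseteq> {1..n} - {i, j} \<longrightarrow>
    mpoly_eval (indicator S) r = mixed_diff (\<lambda>a. mpoly_eval a q) i j S"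
proof -
  have "\<forall>m\<in>Poly_Mapping.keys q. \<exists>r\<in>polys_le ({1..n} - {i, j}) t. \<forall>S. S \<subseteq> {1..n} - {i, j} \<longrightarrow>
      mpoly_eval (indicator S) r = mixed_diff (\<lambda>a. monom_value a m) i j S"
    using q mixed_diff_monom[OF _ _ \<open>i \<noteq> j\<close>] unfolding polys_le_iff by blast
  then obtain r where r: "\<And>m. m \<in> Poly_Mapping.keys q \<Longrightarrow> r m \<in> polys_le ({1..n} - {i, j}) t"
      "\<And>m S. m \<in> Poly_Mapping.keys q \<Longrightarrow> S \<subseteq> {1..n} - {i, j} \<Longrightarrow>
        mpoly_eval (indicator S) (r m) = mixed_diff (\<lambda>a. monom_value a m) i j S"
    by metis
  let ?r = "\<Sum>m\<in>Poly_Mapping.keys q. Const (Poly_Mapping.lookup q m) * r m"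
  have "?r \<in> polys_le ({1..n} - {i, j}) t"
    using r(1) by (intro polys_le_sum polys_le_Const_mult) auto
  moreover have "mpoly_eval (indicator S) ?r = mixed_diff (\<lambda>a. mpoly_eval a q) i j S"
    if "S \<subseteq> {1..n} - {i, j}" for S
    using that
    by (simp add: eval_sum eval_simps r(2) mixed_diff_def eval_monom_value[of _ q]
        sum.distrib sum_subtractf algebra_simps)
  ultimately show ?thesis by blast
qed


section \<open>The equivalence\<close>

definition defect_poly :: "nat mpoly \<Rightarrow> xys mpoly" where
  "defect_poly F = mpoly_subst (\<lambda>i. Var (Xv i)) F + mpoly_subst (\<lambda>i. Var (Yv i)) F
     - mpoly_subst (\<lambda>i. Var (Xv i) + Var (Yv i) - Var (Sv i)) F
     - mpoly_subst (\<lambda>i. Var (Sv i)) F"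

lemma vars_defect_poly:
  assumes "vars F \<subseteq> {1..n}"
  shows "vars (defect_poly F) \<subseteq> xys_vars n"
proof (rule polys_le_vars)
  show "defect_poly F \<in> polys_le (xys_vars n) (total_degree F)"
    unfolding defect_poly_def
    by (intro polys_le_add polys_le_diff polys_le_subst[OF polys_le_total_degree[OF assms]]
        polys_le_xys)
qed

lemma eval_defect_poly:
  assumes "A \<subseteq> {1..n}" "B \<subseteq> {1..n}"
  shows "mpoly_eval (pair_point A B) (defect_poly (MLE n f)) = f A + f B - f (A \<union> B) - f (A \<inter> B)"
proof -
  have "(\<lambda>i. indicator A i + indicator B i - indicator (A \<inter> B) i) =
      (indicator (A \<union> B) :: nat \<Rightarrow> real)"
    by (auto simp: indicator_def)
  moreover have "A \<union> B \<subseteq> {1..n}" "A \<inter> B \<subseteq> {1..n}" using assms by auto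
  ultimately show ?thesis
    using assms by (simp add: defect_poly_def eval_simps eval_subst MLE_props(3))
qed

lemma sos_submodular_iff_values:
  "sos_submodular t n f \<longleftrightarrow>
    (\<forall>i\<in>{1..n}. \<forall>j\<in>{1..n}. i \<noteq> j \<longrightarrow>
      sos_values ({1..n} - {i, j}) t (indicator ` Pow ({1..n} - {i, j}))
        (\<lambda>a. mpoly_eval a (- mpoly_deriv i (mpoly_deriv j (MLE n f)))))"
  unfolding sos_submodular_def
  by (simp only: sos_modulo_iff_values[OF I2_eq_vanishing vars_second_deriv_MLE] finite_Diff
      finite_atLeastAtMost)

text \<open>
  The degree budget of \<open>t + 2\<close> is spent on a factor of degree \<open>2\<close> that singles out the pairs with
  \<open>i \<in> A - B\<close> and \<open>j \<in> B - A\<close>, and on the squares for the pair \<open>i, j\<close>, evaluated at a stage.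
\<close>

lemma sos_defect_if_sos_submodular:
  assumes "sos_submodular t n f"
  shows "sos_values (xys_vars n) (t + 2) (pair_points n) (\<lambda>a. mpoly_eval a (defect_poly (MLE n f)))"
proof -
  define d where "d i j = - mpoly_deriv i (mpoly_deriv j (MLE n f))" for i j
  define sel where "sel i j = (Var (Xv i) - Var (Sv i)) * (Var (Yv j) - Var (Sv j))" for i j
  define K where "K = {(i, j). i \<in> {1..n} \<and> j \<in> {1..n} \<and> i \<noteq> j}"
  define h where "h = (\<lambda>(i, j) a. (mpoly_eval a (sel i j))\<^sup>2
    * mpoly_eval a (mpoly_subst (stage_form i j) (d i j)))"
  have "sos_values (xys_vars n) (t + 2) (pair_points n) (h (i, j))" if ij: "(i, j) \<in> K" for i j
    unfolding h_def prod.case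
  proof (rule sos_values_pullback)
    let ?V = "{1..n} - {i, j}"
    show "sos_values ?V t (indicator ` Pow ?V) (\<lambda>a. mpoly_eval a (d i j))"
      using assms ij unfolding sos_submodular_iff_values K_def d_def by blast
    show "vars (d i j) \<subseteq> ?V" unfolding d_def by (rule vars_second_deriv_MLE)
    show "stage_form i j k \<in> polys_le (xys_vars n) 1" if "k \<in> ?V" for k
      using that polys_le_xys[of k n] by (auto simp: stage_form_def intro!: polys_le_add polys_le_diff)
    have "sel i j \<in> polys_le (xys_vars n) (1 + 1)"
      unfolding sel_def using ij
      by (intro polys_le_mult polys_le_diff polys_le_xys) (auto simp: K_def)
    then show "sel i j \<in> polys_le (xys_vars n) 2" by (simp add: numeral_2_eq_2)
    \<comment> \<open>the derivative does not see the coordinates \<open>i\<close> and \<open>j\<close>, so the stage may be cut down to \<open>?V\<close>\<close>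
    fix b assume "b \<in> pair_points n"
    then obtain A B where b: "b = pair_point A B" by (rule pair_pointsE)
    show "\<exists>a\<in>indicator ` Pow ?V. \<forall>k\<in>?V. mpoly_eval b (stage_form i j k) = a k"
      unfolding b eval_stage_form
      by (intro bexI[of _ "indicator (stage A B i j \<inter> ?V)"]) (auto simp: indicator_def)
  qed
  then have "sos_values (xys_vars n) (t + 2) (pair_points n) (\<lambda>a. \<Sum>k\<in>K. h k a)"
    by (intro sos_values_sum) auto
  moreover have "(\<Sum>k\<in>K. h k a) = mpoly_eval a (defect_poly (MLE n f))" if pt: "a \<in> pair_points n" for a
  proof -
    obtain A B where AB: "A \<subseteq> {1..n}" "B \<subseteq> {1..n}" and a: "a = pair_point A B"
      using pair_pointsE[OF pt] .
    have fin: "finite A" "finite B" using AB finite_subset by blast+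
    have "finite K" by (rule finite_subset[of _ "{1..n} \<times> {1..n}"]) (auto simp: K_def)
    have "h (i, j) a = (if i \<in> A - B \<and> j \<in> B - A then - second_diff f i j (stage A B i j) else 0)"
      if ij: "(i, j) \<in> K" for i j
    proof (cases "i \<in> A - B \<and> j \<in> B - A")
      case True
      have "stage A B i j \<subseteq> {1..n} - {i, j}"
        using True AB by (auto simp: stage_def)
      then have "mpoly_eval a (mpoly_subst (stage_form i j) (d i j)) = - second_diff f i j (stage A B i j)"
        using ij unfolding a eval_subst eval_stage_form d_def eval_uminus
        by (simp add: eval_second_deriv_MLE K_def)
      then show ?thesis using True by (simp add: h_def a sel_def eval_simps)
    next
      case False
      then have "mpoly_eval a (sel i j) = 0"
        by (auto simp: a sel_def eval_simps indicator_def)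
      then show ?thesis using False by (auto simp: h_def)
    qed
    then have "(\<Sum>k\<in>K. h k a) = (\<Sum>(i, j)\<in>K.
        if i \<in> A - B \<and> j \<in> B - A then - second_diff f i j (stage A B i j) else 0)"
      by (intro sum.cong) auto
    also have "\<dots> = (\<Sum>(i, j)\<in>(A - B) \<times> (B - A). - second_diff f i j (stage A B i j))"
      using AB \<open>finite K\<close> by (intro sum.mono_neutral_cong_right) (auto simp: K_def split: if_splits)
    also have "\<dots> = mpoly_eval a (defect_poly (MLE n f))"
      by (simp only: a eval_defect_poly[OF AB] submodularity_defect[OF fin] sum.cartesian_product)
    finally show ?thesis .
  qed
  ultimately show ?thesis by (simp add: sos_values_def)
qed

text \<open>
  The polynomials squared for the pair \<open>i, j\<close> are not the restrictions of those for the defect but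
  their mixed differences, which have the same values and degree at most \<open>t\<close>.
\<close>

lemma sos_submodular_if_sos_defect:
  assumes "sos_values (xys_vars n) (t + 2) (pair_points n) (\<lambda>a. mpoly_eval a (defect_poly (MLE n f)))"
  shows "sos_submodular t n f"
  unfolding sos_submodular_iff_values
proof (intro ballI impI)
  fix i j assume ij: "i \<in> {1..n}" "j \<in> {1..n}" "i \<noteq> j"
  let ?V = "{1..n} - {i, j}"
  obtain qs where qs: "set qs \<subseteq> polys_le (xys_vars n) (t + 2)"
      "\<And>a. a \<in> pair_points n \<Longrightarrow>
        mpoly_eval a (defect_poly (MLE n f)) = (\<Sum>q\<leftarrow>qs. (mpoly_eval a q)\<^sup>2)"
    using assms unfolding sos_values_def by blast
  have sum: "(\<Sum>q\<leftarrow>qs. (mpoly_eval (pair_point A B) q)\<^sup>2) = f A + f B - f (A \<union> B) - f (A \<inter> B)"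
    if "A \<subseteq> {1..n}" "B \<subseteq> {1..n}" for A B
    using qs(2)[OF pair_pointsI[OF that]] eval_defect_poly[OF that, of f] by simp
  \<comment> \<open>nested sets have no defect, and a sum of squares vanishes only if each square does\<close>
  have zero: "mpoly_eval (pair_point A B) q = 0"
    if "A \<subseteq> B \<or> B \<subseteq> A" "A \<subseteq> {1..n}" "B \<subseteq> {1..n}" "q \<in> set qs" for A B q
  proof -
    have "f A + f B - f (A \<union> B) - f (A \<inter> B) = 0"
      using that(1) by (auto simp: Un_absorb1 Un_absorb2 Int_absorb1 Int_absorb2)
    then have "(\<Sum>q\<leftarrow>qs. (mpoly_eval (pair_point A B) q)\<^sup>2) = 0"
      using sum that by simp
    then have "\<forall>c\<in>set (map (\<lambda>q. (mpoly_eval (pair_point A B) q)\<^sup>2) qs). c = 0"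
      by (subst (asm) sum_list_nonneg_eq_0_iff) auto
    then show ?thesis using that(4) by simp
  qed
  have "\<forall>q\<in>set qs. \<exists>r. r \<in> polys_le ?V t \<and>
      (\<forall>S. S \<subseteq> ?V \<longrightarrow> mpoly_eval (indicator S) r = mixed_diff (\<lambda>a. mpoly_eval a q) i j S)"
  proof
    fix q assume "q \<in> set qs"
    then show "\<exists>r. r \<in> polys_le ?V t \<and>
        (\<forall>S. S \<subseteq> ?V \<longrightarrow> mpoly_eval (indicator S) r = mixed_diff (\<lambda>a. mpoly_eval a q) i j S)"
      using mixed_diff_poly[OF subsetD[OF qs(1)] ij(3)] by (simp only: Bex_def)
  qed
  from bchoice[OF this] obtain r where r: "\<And>q. q \<in> set qs \<Longrightarrow> r q \<in> polys_le ?V t"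
      "\<And>q S. q \<in> set qs \<Longrightarrow> S \<subseteq> ?V \<Longrightarrow>
        mpoly_eval (indicator S) (r q) = mixed_diff (\<lambda>a. mpoly_eval a q) i j S"
    by blast
  have "mpoly_eval (indicator S) (- mpoly_deriv i (mpoly_deriv j (MLE n f))) =
      (\<Sum>q\<leftarrow>map r qs. (mpoly_eval (indicator S) q)\<^sup>2)" if S: "S \<subseteq> ?V" for S
  proof -
    have sub: "S \<subseteq> {1..n}" "insert i S \<subseteq> {1..n}" "insert j S \<subseteq> {1..n}" using S ij by auto
    \<comment> \<open>three of the four points of the mixed difference are pairs of nested sets\<close>
    have "mpoly_eval (indicator S) (r q) = mpoly_eval (pair_point (insert i S) (insert j S)) q"
      if "q \<in> set qs" for q
      using zero[of "insert i S" S q] zero[of S "insert j S" q] zero[of S S q] sub that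
      by (simp add: r(2)[OF that S] mixed_diff_def subset_insertI)
    then have "(\<Sum>q\<leftarrow>map r qs. (mpoly_eval (indicator S) q)\<^sup>2) =
        (\<Sum>q\<leftarrow>qs. (mpoly_eval (pair_point (insert i S) (insert j S)) q)\<^sup>2)"
      by (auto intro!: arg_cong[where f = sum_list])
    also have "\<dots> = f (insert i S) + f (insert j S) - f (insert i S \<union> insert j S)
        - f (insert i S \<inter> insert j S)"
      using sub by (intro sum)
    also have "insert i S \<union> insert j S = insert i (insert j S)" by auto
    also have "insert i S \<inter> insert j S = S" using S ij(3) by auto
    finally show ?thesis
      using eval_second_deriv_MLE[OF ij S, of f] by (simp add: eval_uminus second_diff_def)
  qed
  then show "sos_values ?V t (indicator ` Pow ?V)
      (\<lambda>a. mpoly_eval a (- mpoly_deriv i (mpoly_deriv j (MLE n f))))"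
    unfolding sos_values_def using r(1) by (intro exI[of _ "map r qs"]) auto
qed

theorem theorem2:
  fixes t n :: nat and f :: "nat set \<Rightarrow> real" and F :: "nat mpoly"
  assumes "F = MLE n f"
  shows "sos_submodular t n f \<longleftrightarrow>
    sos_modulo (xys_vars n) (t + 2) (I0 n)
      (mpoly_subst (\<lambda>i. Var (Xv i)) F + mpoly_subst (\<lambda>i. Var (Yv i)) F
       - mpoly_subst (\<lambda>i. Var (Xv i) + Var (Yv i) - Var (Sv i)) F
       - mpoly_subst (\<lambda>i. Var (Sv i)) F)"
proof -
  have "vars (defect_poly F) \<subseteq> xys_vars n"
    unfolding assms by (intro vars_defect_poly MLE_props)
  then have "sos_modulo (xys_vars n) (t + 2) (I0 n) (defect_poly F) \<longleftrightarrow>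
      sos_values (xys_vars n) (t + 2) (pair_points n) (\<lambda>a. mpoly_eval a (defect_poly F))"
    by (rule sos_modulo_iff_values[OF I0_eq_vanishing])
  then show ?thesis
    using sos_defect_if_sos_submodular sos_submodular_if_sos_defect
    unfolding assms defect_poly_def by blast
qed

end
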